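(* Asymptotically almost surely, the cliquewidth of a graph drawn randomly from $G(n,\frac12)$ is $\Theta(n)$. That is, there exist constants $0<c\le C$ such that, for $G$ drawn from $G(n,\frac12)$, $$\lim_{n\to\infty}\Pr\big[c\,n\le \mathrm{cw}(G)\le C\,n\big]=1,$$ where $\mathrm{cw}(G)$ denotes the cliquewidth of $G$.
   Context: $G(n,\frac12)$ is the random simple graph on $n$ labelled vertices in which each of the $\binom n2$ possible edges appears independently with probability $\frac12$. Cliquewidth is the standard notion: $\mathrm{cw}(G)$ is the minimum $k$ such that $G$, with some labelling of its vertices by labels in $\{1,\dots,k\}$, can be built using the operations: (i) create a single vertex with a label $i\in\{1,\dots,k\}$; (ii) take the disjoint union of two labelled graphs; (iii) for labels $i\ne j$, add all edges between vertices labelled $i$ and vertices labelled $j$; (iv) for labels $i\neq j$, change every label $i$ to $j$. *)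

theory Defs
  imports "HOL-Probability.Probability" "HOL-Library.Ramsey"
begin

text \<open>A finite simple graph is given by its vertex set \<open>V\<close> and a set \<open>E\<close> of
  two-element subsets of \<open>V\<close>, i.e. \<open>E \<subseteq> [V]\<^bsup>2\<^esup>\<close>.\<close>

text \<open>Labellings are total functions; only their values on \<open>V\<close> are relevant, every
  operation reading and changing labels of vertices in \<open>V\<close> only.\<close>

inductive cw_built :: "nat \<Rightarrow> 'a set \<Rightarrow> 'a set set \<Rightarrow> ('a \<Rightarrow> nat) \<Rightarrow> bool" for k where
  vertex: "i \<in> {1..k} \<Longrightarrow> cw_built k {v} {} (\<lambda>_. i)"
| union: "cw_built k V1 E1 l1 \<Longrightarrow> cw_built k V2 E2 l2 \<Longrightarrow> V1 \<inter> V2 = {} \<Longrightarrow>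
    cw_built k (V1 \<union> V2) (E1 \<union> E2) (\<lambda>v. if v \<in> V1 then l1 v else l2 v)"
| join: "cw_built k V E l \<Longrightarrow> i \<in> {1..k} \<Longrightarrow> j \<in> {1..k} \<Longrightarrow> i \<noteq> j \<Longrightarrow>
    cw_built k V (E \<union> {{u, v} |u v. u \<in> V \<and> v \<in> V \<and> l u = i \<and> l v = j}) l"
| relabel: "cw_built k V E l \<Longrightarrow> i \<in> {1..k} \<Longrightarrow> j \<in> {1..k} \<Longrightarrow> i \<noteq> j \<Longrightarrow>
    cw_built k V E (\<lambda>v. if l v = i then j else l v)"

text \<open>By \<open>cw_built_exists\<close> below, the minimum is attained for every finite simple graph with
  at least one vertex.  The empty graph cannot be built, and its value is irrelevant.\<close>

definition cliquewidth :: "'a set \<Rightarrow> 'a set set \<Rightarrow> nat" where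
  "cliquewidth V E = (LEAST k. \<exists>l. cw_built k V E l)"

definition random_graph :: "nat \<Rightarrow> real \<Rightarrow> nat set set pmf" where
  "random_graph n p = map_pmf (\<lambda>present. {e \<in> [{1..n}]\<^bsup>2\<^esup>. present e})
     (Pi_pmf ([{1..n}]\<^bsup>2\<^esup>) False (\<lambda>_. bernoulli_pmf p))"

lemma cw_built_simple_graph:
  "cw_built k V E l \<Longrightarrow> finite V \<and> V \<noteq> {} \<and> E \<subseteq> [V]\<^bsup>2\<^esup> \<and> l ` V \<subseteq> {1..k}"
proof (induction rule: cw_built.induct)
  case (union V1 E1 l1 V2 E2 l2)
  then show ?case
    using nsets_mono[of V1 "V1 \<union> V2" 2] nsets_mono[of V2 "V1 \<union> V2" 2] by auto
qed auto

lemma cw_built_edgeless: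
  assumes "finite V" "V \<noteq> {}" "l ` V \<subseteq> {1..k}"
  shows "\<exists>l'. cw_built k V {} l' \<and> (\<forall>v\<in>V. l' v = l v)"
  using assms
proof (induction V rule: finite_ne_induct)
  case (singleton x)
  then show ?case using cw_built.vertex[of "l x" k x] by auto
next
  case (insert x F)
  then obtain l' where l': "cw_built k F {} l'" "\<forall>v\<in>F. l' v = l v" by auto
  have "cw_built k {x} {} (\<lambda>_. l x)" using insert.prems by (intro cw_built.vertex) auto
  from cw_built.union[OF this l'(1)] insert.hyps l'(2)
  have "cw_built k (insert x F) {} (\<lambda>v. if v \<in> {x} then l x else l' v)" by auto
  then show ?case using l'(2) by (intro exI conjI) auto
qed

lemma cw_built_exists:
  assumes "finite V" "V \<noteq> {}" "E \<subseteq> [V]\<^bsup>2\<^esup>"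
  shows "\<exists>l. cw_built (card V) V E l"
proof -
  obtain h where "bij_betw h V {1..card V}"
    using ex_bij_betw_finite_nat[OF assms(1)] bij_betw_trans
    by (metis assms(1) card_atLeastAtMost diff_Suc_1 finite_atLeastAtMost finite_same_card_bij)
  then have inj: "inj_on h V" and im: "h ` V \<subseteq> {1..card V}"
    by (auto simp: bij_betw_def)
  obtain l where l: "cw_built (card V) V {} l" "\<forall>v\<in>V. l v = h v"
    using cw_built_edgeless[OF assms(1,2) im] by blast
  have "finite E"
    using assms(1,3) finite_imp_finite_nsets finite_subset by blast
  then have "cw_built (card V) V E l"
    using assms(3)
  proof (induction E rule: finite_induct)
    case empty
    then show ?case using l(1) by simp
  next
    case (insert e F)
    then obtain x y where e: "e = {x, y}" "x \<in> V" "y \<in> V" "x \<noteq> y"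
      by (auto simp: nsets_2_eq)
    have ne: "h x \<noteq> h y" using e inj by (auto dest: inj_onD)
    have "{{u, v} |u v. u \<in> V \<and> v \<in> V \<and> l u = h x \<and> l v = h y} = {e}"
      using e l(2) inj by (auto dest: inj_onD)
    moreover have "h x \<in> {1..card V}" "h y \<in> {1..card V}" using im e by auto
    moreover have "cw_built (card V) V F l" using insert by auto
    ultimately show ?case
      using cw_built.join[of "card V" V F l "h x" "h y"] ne by simp
  qed
  then show ?thesis by blast
qed

end

theory Submission
  imports Defs "HOL-Real_Asymp.Real_Asymp"
begin

text \<open>
  The upper bound is trivial: giving every vertex its own label builds any graph, so the
  cliquewidth of a graph on \<open>n\<close> vertices is at most \<open>n\<close>.

  For the lower bound, call a vertex \<open>w\<close> a distinguisher of two other vertices \<open>u\<close> and \<open>v\<close> if it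
  is adjacent to exactly one of them.  Once \<open>u\<close> and \<open>v\<close> carry the same label during a
  construction, no later operation can produce a new distinguisher, so all distinguishers already
  belong to the part of the graph built so far.  With \<open>k\<close> labels and more than \<open>k\<close> vertices, follow
  the construction down to a union whose two sides both have at most \<open>k\<close> vertices while the
  result has more than \<open>k\<close>: some two of these at most \<open>2k\<close> vertices share a label.  Hence every
  graph of cliquewidth \<open>k < n\<close> has two vertices with at most \<open>2k\<close> distinguishers
  (\<open>few_distinguishers_if_cw_built\<close>).

  In a uniformly random graph the distinguishers of two fixed vertices form a uniformly random set
  of the \<open>n - 2\<close> others, because flipping the edge between \<open>u\<close> and \<open>w\<close> flips whether \<open>w\<close>
  distinguishes.  So typically about half of the vertices are distinguishers, and the probability
  that at most a quarter are is exponentially small (\<open>prob_few_distinguishers\<close>).  This beats the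
  union bound over the fewer than \<open>n\<^sup>2\<close> pairs, so a.a.s. the cliquewidth is at least \<open>n/8\<close>.
\<close>

section \<open>Pairs with few distinguishers\<close>

definition distinguishers :: "'a set \<Rightarrow> 'a set set \<Rightarrow> 'a \<Rightarrow> 'a \<Rightarrow> 'a set" where
  "distinguishers V E u v = {w \<in> V - {u, v}. ({u, w} \<in> E) \<noteq> ({v, w} \<in> E)}"

text \<open>Right after a disjoint union, no vertex of one side is adjacent to \<open>u\<close> or \<open>v\<close> on the other
  side, so none of them distinguishes \<open>u\<close> from \<open>v\<close>.\<close>

lemma distinguishers_disjoint_union:
  assumes "E1 \<subseteq> [V1]\<^bsup>2\<^esup>" "E2 \<subseteq> [V2]\<^bsup>2\<^esup>" "V1 \<inter> V2 = {}" "u \<in> V1" "v \<in> V1"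
  shows "distinguishers (V1 \<union> V2) (E1 \<union> E2) u v = distinguishers V1 E1 u v"
proof -
  have "{x, w} \<notin> E2" if "x \<in> V1" for x w
    using assms(2,3) that by (auto simp: nsets_def)
  moreover have "{x, w} \<notin> E1" if "w \<in> V2" for x w
    using assms(1,3) that by (auto simp: nsets_def)
  ultimately show ?thesis
    using assms(3-5) by (auto simp: distinguishers_def)
qed

text \<open>The induction carries along that \<open>u\<close> and \<open>v\<close> have the same label: this is what prevents later
  joins from distinguishing them, and later relabellings cannot separate them.\<close>

lemma few_distinguishers_if_cw_built:
  assumes "cw_built k V E l" "k < card V"
  shows "\<exists>u\<in>V. \<exists>v\<in>V. u \<noteq> v \<and> l u = l v \<and> card (distinguishers V E u v) \<le> 2 * k"
  using assms
proof (induction rule: cw_built.induct)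
  case (vertex i v)
  then show ?case by simp
next
  case (union V1 E1 l1 V2 E2 l2)
  note simple1 = cw_built_simple_graph[OF union.hyps(1)]
    and simple2 = cw_built_simple_graph[OF union.hyps(2)]
  let ?l = "\<lambda>v. if v \<in> V1 then l1 v else l2 v"
  consider "k < card V1" | "k < card V2" | "card V1 \<le> k" "card V2 \<le> k" by linarith
  then show ?case
  proof cases
    case 1
    then obtain u v where "u \<in> V1" "v \<in> V1" "u \<noteq> v" "l1 u = l1 v"
      "card (distinguishers V1 E1 u v) \<le> 2 * k"
      using union.IH(1) by blast
    then show ?thesis
      using distinguishers_disjoint_union[of E1 V1 E2 V2 u v] simple1 simple2 union.hyps(3)
      by (intro bexI[of _ u] bexI[of _ v]) auto
  next
    case 2
    then obtain u v where uv: "u \<in> V2" "v \<in> V2" "u \<noteq> v" "l2 u = l2 v"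
      "card (distinguishers V2 E2 u v) \<le> 2 * k"
      using union.IH(2) by blast
    moreover have "distinguishers (V1 \<union> V2) (E1 \<union> E2) u v = distinguishers V2 E2 u v"
      using distinguishers_disjoint_union[of E2 V2 E1 V1 u v] simple1 simple2 union.hyps(3) uv
      by (simp add: Un_commute Int_commute)
    moreover have "u \<notin> V1" "v \<notin> V1" using uv union.hyps(3) by auto
    ultimately show ?thesis
      by (intro bexI[of _ u] bexI[of _ v]) auto
  next
    case 3
    have labels: "?l ` (V1 \<union> V2) \<subseteq> {1..k}" using simple1 simple2 by auto
    have "\<not> inj_on ?l (V1 \<union> V2)"
    proof
      assume "inj_on ?l (V1 \<union> V2)"
      then have "card (V1 \<union> V2) \<le> card {1..k}"
        by (rule card_inj_on_le) (use labels in auto)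
      then show False using union.prems by simp
    qed
    then obtain u v where uv: "u \<in> V1 \<union> V2" "v \<in> V1 \<union> V2" "?l u = ?l v" "u \<noteq> v"
      unfolding inj_on_def by blast
    have "card (distinguishers (V1 \<union> V2) (E1 \<union> E2) u v) \<le> card (V1 \<union> V2)"
      using simple1 simple2 by (intro card_mono) (auto simp: distinguishers_def)
    also have "\<dots> \<le> 2 * k" using 3 card_Un_le[of V1 V2] by linarith
    finally show ?thesis using uv by blast
  qed
next
  case (join V E l i j)
  then obtain u v where uv: "u \<in> V" "v \<in> V" "u \<noteq> v" "l u = l v"
    "card (distinguishers V E u v) \<le> 2 * k" by blast
  let ?F = "{{u, v} |u v. u \<in> V \<and> v \<in> V \<and> l u = i \<and> l v = j}"
  have "{x, w} \<in> ?F \<longleftrightarrow> (l x = i \<and> l w = j \<or> l w = i \<and> l x = j)" if "x \<in> V" "w \<in> V" for x w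
    using that by (auto simp: doubleton_eq_iff)
  then have "{u, w} \<in> ?F \<longleftrightarrow> {v, w} \<in> ?F" if "w \<in> V" for w
    using that uv(1,2,4) by presburger
  then have "distinguishers V (E \<union> ?F) u v \<subseteq> distinguishers V E u v"
    unfolding distinguishers_def by blast
  moreover have "finite (distinguishers V E u v)"
    using cw_built_simple_graph[OF join.hyps(1)] by (simp add: distinguishers_def)
  ultimately have "card (distinguishers V (E \<union> ?F) u v) \<le> 2 * k"
    using uv(5) card_mono le_trans by blast
  then show ?case using uv by blast
next
  case (relabel V E l i j)
  then obtain u v where "u \<in> V" "v \<in> V" "u \<noteq> v" "l u = l v"
    "card (distinguishers V E u v) \<le> 2 * k" by blast
  then show ?case by (intro bexI[of _ u] bexI[of _ v]) auto
qed

section \<open>Distinguishers in a random graph\<close>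

text \<open>A graph with given distinguishers of \<open>u\<close> and \<open>v\<close> is determined by its edges outside the star
  from \<open>u\<close> to the remaining vertices: whether \<open>w\<close> is adjacent to \<open>u\<close> can be read off from whether
  it is adjacent to \<open>v\<close> and whether it is a distinguisher.\<close>

lemma card_graphs_with_distinguishers:
  assumes "finite V" "u \<in> V" "v \<in> V" "u \<noteq> v"
  shows "card {E \<in> Pow ([V]\<^bsup>2\<^esup>). distinguishers V E u v = S}
           * 2 ^ (card V - 2) \<le> 2 ^ card ([V]\<^bsup>2\<^esup>)"
proof -
  define W where "W = V - {u, v}"
  define star where "star = (\<lambda>w. {u, w}) ` W"
  let ?P = "[V]\<^bsup>2\<^esup>"
  let ?G = "{E \<in> Pow ?P. distinguishers V E u v = S}"
  have finP: "finite ?P" using assms(1) by (simp add: finite_imp_finite_nsets)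
  have cardW: "card W = card V - 2"
    unfolding W_def using assms by (subst card_Diff_subset) auto
  have "inj_on (\<lambda>w. {u, w}) W" by (auto simp: inj_on_def doubleton_eq_iff)
  then have card_star: "card star = card V - 2"
    unfolding star_def cardW[symmetric] by (rule card_image)
  have star_sub: "star \<subseteq> ?P"
    using assms(2) by (auto simp: star_def W_def nsets_def)
  have inj: "inj_on (\<lambda>E. E - star) ?G"
  proof (rule inj_onI)
    fix E F assume E: "E \<in> ?G" and F: "F \<in> ?G" and eq: "E - star = F - star"
    have "{u, w} \<in> E \<longleftrightarrow> {u, w} \<in> F" if w: "w \<in> W" for w
    proof -
      have "{v, w} \<notin> star" using w assms(4) by (auto simp: star_def W_def doubleton_eq_iff)
      then have "{v, w} \<in> E \<longleftrightarrow> {v, w} \<in> F" using eq by blast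
      moreover have "w \<in> distinguishers V E u v \<longleftrightarrow> w \<in> distinguishers V F u v"
        using E F by simp
      ultimately show ?thesis using w by (auto simp: distinguishers_def W_def)
    qed
    then have "E \<inter> star = F \<inter> star" by (auto simp: star_def)
    with eq show "E = F" by blast
  qed
  have "card ?G \<le> card (Pow (?P - star))"
    by (rule card_inj_on_le[OF inj]) (use finP in auto)
  also have "\<dots> = 2 ^ card (?P - star)" using finP by (simp add: card_Pow)
  finally have "card ?G * 2 ^ (card V - 2) \<le> 2 ^ card (?P - star) * 2 ^ card star"
    by (simp add: card_star)
  also have "\<dots> = 2 ^ (card (?P - star) + card star)" by (simp add: power_add)
  also have "card (?P - star) + card star = card ?P"
    using card_Diff_subset[OF finite_subset[OF star_sub finP] star_sub] card_mono[OF finP star_sub]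
    by linarith
  finally show ?thesis .
qed

text \<open>Chernoff's argument: weigh each subset \<open>S\<close> with \<open>x ^ card S\<close>; small sets weigh at least
  \<open>x ^ a\<close>, and all sets together weigh \<open>(1 + x) ^ card W\<close> by the binomial theorem.\<close>

lemma card_small_subsets_le:
  fixes x :: real
  assumes "finite W" "0 \<le> x" "x \<le> 1"
  shows "real (card {S \<in> Pow W. card S \<le> a}) * x ^ a \<le> (1 + x) ^ card W"
proof -
  have "real (card {S \<in> Pow W. card S \<le> a}) * x ^ a = (\<Sum>S\<in>{S \<in> Pow W. card S \<le> a}. x ^ a)"
    by simp
  also have "\<dots> \<le> (\<Sum>S\<in>{S \<in> Pow W. card S \<le> a}. x ^ card S)"
    using assms by (intro sum_mono power_decreasing) auto
  also have "\<dots> \<le> (\<Sum>S\<in>Pow W. x ^ card S)"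
    using assms by (intro sum_mono2) auto
  also have "\<dots> = (\<Prod>w\<in>W. x + 1)"
    using assms(1) by (subst prod_add) auto
  finally show ?thesis by (simp add: add.commute)
qed

lemma random_graph_half: "random_graph n (1/2) = pmf_of_set (Pow ([{1..n}]\<^bsup>2\<^esup>))"
  unfolding random_graph_def
  by (rule pmf_of_set_Pow_conv_bernoulli) (simp add: finite_imp_finite_nsets)

lemma prob_few_distinguishers:
  assumes "u \<in> {1..n}" "v \<in> {1..n}" "u \<noteq> v"
  shows "measure_pmf.prob (random_graph n (1/2)) {E. card (distinguishers {1..n} E u v) \<le> a}
           \<le> 2 ^ a * (3/4) ^ (n - 2)"
proof -
  define W where "W = {1..n} - {u, v}"
  let ?P = "[{1..n}]\<^bsup>2\<^esup>"
  let ?D = "\<lambda>E. distinguishers {1..n} E u v"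
  let ?small = "{S \<in> Pow W. card S \<le> a}"
  have finP: "finite ?P" by (simp add: finite_imp_finite_nsets)
  have cardW: "card W = n - 2"
    unfolding W_def using assms by (subst card_Diff_subset) auto
  have "Pow ?P \<inter> {E. card (?D E) \<le> a} = (\<Union>S\<in>?small. {E \<in> Pow ?P. ?D E = S})"
    by (auto simp: distinguishers_def W_def)
  then have "card (Pow ?P \<inter> {E. card (?D E) \<le> a}) \<le> (\<Sum>S\<in>?small. card {E \<in> Pow ?P. ?D E = S})"
    by (simp add: card_UN_le W_def)
  then have "card (Pow ?P \<inter> {E. card (?D E) \<le> a}) * 2 ^ (n - 2)
      \<le> (\<Sum>S\<in>?small. card {E \<in> Pow ?P. ?D E = S} * 2 ^ (n - 2))"
    by (simp flip: sum_distrib_right)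
  also have "\<dots> \<le> (\<Sum>S\<in>?small. 2 ^ card ?P)"
    using card_graphs_with_distinguishers[of "{1..n}" u v] assms by (intro sum_mono) auto
  finally have "card (Pow ?P \<inter> {E. card (?D E) \<le> a}) * 2 ^ (n - 2) \<le> card ?small * 2 ^ card ?P"
    by simp
  then have "real (card (Pow ?P \<inter> {E. card (?D E) \<le> a}) * 2 ^ (n - 2))
      \<le> real (card ?small * 2 ^ card ?P)"
    by (simp only: of_nat_le_iff)
  then have "real (card (Pow ?P \<inter> {E. card (?D E) \<le> a})) / 2 ^ card ?P
      \<le> real (card ?small) / 2 ^ (n - 2)"
    by (simp add: field_simps)
  moreover have "measure_pmf.prob (random_graph n (1/2)) {E. card (?D E) \<le> a}
      = real (card (Pow ?P \<inter> {E. card (?D E) \<le> a})) / 2 ^ card ?P"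
    unfolding random_graph_half using finP by (subst measure_pmf_of_set) (auto simp: card_Pow)
  ultimately have "measure_pmf.prob (random_graph n (1/2)) {E. card (?D E) \<le> a}
      \<le> real (card ?small) / 2 ^ (n - 2)"
    by simp
  also have "real (card ?small) \<le> 2 ^ a * (3/2) ^ (n - 2)"
    using card_small_subsets_le[of W "1/2" a] cardW by (simp add: W_def field_simps)
  finally show ?thesis
    by (simp add: divide_right_mono power_divide field_simps flip: power_mult_distrib)
qed

section \<open>Cliquewidth of the random graph\<close>

lemma cliquewidth_le_card:
  assumes "finite V" "V \<noteq> {}" "E \<subseteq> [V]\<^bsup>2\<^esup>"
  shows "cliquewidth V E \<le> card V"
  unfolding cliquewidth_def using cw_built_exists[OF assms] by (rule Least_le)

lemma cw_built_cliquewidth: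
  assumes "finite V" "V \<noteq> {}" "E \<subseteq> [V]\<^bsup>2\<^esup>"
  shows "\<exists>l. cw_built (cliquewidth V E) V E l"
  unfolding cliquewidth_def using cw_built_exists[OF assms] by (rule LeastI)

lemma prob_linear_cliquewidth_ge:
  assumes "n > 0"
  shows "measure_pmf.prob (random_graph n (1/2))
           {E. 1/8 * real n \<le> real (cliquewidth {1..n} E) \<and> real (cliquewidth {1..n} E) \<le> 1 * real n}
         \<ge> 1 - real n ^ 2 * ((6/5) ^ n * (3/4) ^ (n - 2))"
    (is "measure_pmf.prob ?G ?good \<ge> _")
proof -
  let ?few = "\<lambda>(u, v). {E. card (distinguishers {1..n} E u v) \<le> n div 4}"
  let ?pairs = "{(u, v). u \<in> {1..n} \<and> v \<in> {1..n} \<and> u \<noteq> v}"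
  have pairs: "?pairs \<subseteq> {1..n} \<times> {1..n}" by auto
  then have fin: "finite ?pairs" by (rule finite_subset) auto
  have card_pairs: "real (card ?pairs) \<le> real n ^ 2"
    using card_mono[OF _ pairs]
    by (simp add: power2_eq_square card_cartesian_product flip: of_nat_mult)
  have support: "set_pmf ?G = Pow ([{1..n}]\<^bsup>2\<^esup>)"
    unfolding random_graph_half
    by (intro set_pmf_of_set) (auto intro: finite_imp_finite_nsets)
  have bad: "E \<in> (\<Union>p\<in>?pairs. ?few p)" if "E \<notin> ?good" "E \<in> set_pmf ?G" for E
  proof -
    let ?k = "cliquewidth {1..n} E"
    have E: "E \<subseteq> [{1..n}]\<^bsup>2\<^esup>" using that support by auto
    have "real ?k < 1/8 * real n"
      using that cliquewidth_le_card[of "{1..n}" E] E assms by auto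
    then have k: "?k < n" "2 * ?k \<le> n div 4" by linarith+
    obtain l where "cw_built ?k {1..n} E l"
      using cw_built_cliquewidth[of "{1..n}" E] E assms by auto
    from few_distinguishers_if_cw_built[OF this] k obtain u v where
      "u \<in> {1..n}" "v \<in> {1..n}" "u \<noteq> v" "card (distinguishers {1..n} E u v) \<le> n div 4"
      by (metis card_atLeastAtMost diff_Suc_1 le_trans)
    then show ?thesis by blast
  qed
  have "measure_pmf.prob ?G (- ?good) \<le> measure_pmf.prob ?G (\<Union>p\<in>?pairs. ?few p)"
    using bad by (intro measure_pmf.finite_measure_mono_AE) (auto simp: AE_measure_pmf_iff)
  also have "\<dots> \<le> (\<Sum>p\<in>?pairs. measure_pmf.prob ?G (?few p))"
    using fin by (intro measure_pmf.finite_measure_subadditive_finite) auto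
  also have "\<dots> \<le> (\<Sum>p\<in>?pairs. 2 ^ (n div 4) * (3/4) ^ (n - 2))"
    using prob_few_distinguishers by (intro sum_mono) auto
  also have "\<dots> = real (card ?pairs) * (2 ^ (n div 4) * (3/4) ^ (n - 2))" by simp
  also have "\<dots> \<le> real n ^ 2 * ((6/5) ^ n * (3/4) ^ (n - 2))"
  proof (intro mult_mono card_pairs)
    \<comment> \<open>\<open>6/5\<close> is a rational upper bound on the fourth root of \<open>2\<close>.\<close>
    have "(2::real) ^ (n div 4) \<le> ((6/5) ^ 4) ^ (n div 4)"
      by (intro power_mono) (simp_all add: power_divide)
    also have "\<dots> = (6/5) ^ (4 * (n div 4))" by (simp add: power_mult)
    also have "\<dots> \<le> (6/5) ^ n" by (intro power_increasing) simp_all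
    finally show "(2::real) ^ (n div 4) \<le> (6/5) ^ n" .
  qed auto
  finally show ?thesis
    using measure_pmf.prob_compl[of ?good ?G] by (simp add: Compl_eq_Diff_UNIV)
qed

theorem corollary4:
  shows "\<exists>c C :: real. 0 < c \<and> c \<le> C \<and>
    (\<lambda>n. measure_pmf.prob (random_graph n (1/2))
       {E. c * real n \<le> real (cliquewidth {1..n} E) \<and> real (cliquewidth {1..n} E) \<le> C * real n})
    \<longlonglongrightarrow> 1"
proof (intro exI conjI)
  show "0 < (1/8 :: real)" "(1/8 :: real) \<le> 1" by simp_all
  \<comment> \<open>The error term vanishes because \<open>(6/5) * (3/4) = 9/10 < 1\<close>; the shift by \<open>2\<close> gets rid of the
    truncated subtraction.\<close>
  have "(\<lambda>n. real n ^ 2 * ((6/5) ^ n * (3/4) ^ (n - 2))) \<longlonglongrightarrow> 0"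
  proof (rule LIMSEQ_offset[where k = 2])
    have "real (n + 2) ^ 2 * ((6/5) ^ (n + 2) * (3/4) ^ (n + 2 - 2))
        = 36/25 * real (n + 2) ^ 2 * (9/10) ^ n" for n
    proof -
      have "(6/5) ^ n * (3/4) ^ n = (9/10 :: real) ^ n" by (simp flip: power_mult_distrib)
      then show ?thesis by (simp add: power_add power2_eq_square)
    qed
    moreover have "(\<lambda>n. 36/25 * real (n + 2) ^ 2 * (9/10) ^ n) \<longlonglongrightarrow> 0" by real_asymp
    ultimately show "(\<lambda>n. real (n + 2) ^ 2 * ((6/5) ^ (n + 2) * (3/4) ^ (n + 2 - 2))) \<longlonglongrightarrow> 0"
      by presburger
  qed
  then have "(\<lambda>n. 1 - real n ^ 2 * ((6/5) ^ n * (3/4) ^ (n - 2))) \<longlonglongrightarrow> 1"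
    using tendsto_diff[OF tendsto_const[of 1]] by fastforce
  then show "(\<lambda>n. measure_pmf.prob (random_graph n (1/2))
      {E. 1/8 * real n \<le> real (cliquewidth {1..n} E) \<and> real (cliquewidth {1..n} E) \<le> 1 * real n})
    \<longlonglongrightarrow> 1"
  proof (rule tendsto_sandwich[rotated 2, OF _ tendsto_const])
    show "\<forall>\<^sub>F n in sequentially. 1 - real n ^ 2 * ((6/5) ^ n * (3/4) ^ (n - 2))
      \<le> measure_pmf.prob (random_graph n (1/2))
      {E. 1/8 * real n \<le> real (cliquewidth {1..n} E) \<and> real (cliquewidth {1..n} E) \<le> 1 * real n}"
      using eventually_gt_at_top[of 0] by eventually_elim (rule prob_linear_cliquewidth_ge)
  qed (auto intro: always_eventually)
qed

end
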